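(* Let $X$ be a Banach space, let $M\subset X$ be a nonempty, closed and bounded set with $\|u\|\ge 1$ for every $u\in M$ and such that $\operatorname{cone}(M)$ is convex, and let $f\colon X\to\mathbb{R}$ be lower semicontinuous and convex. For every $\epsilon>0$ define $$\mathcal{G}(\epsilon):=\{x\in X\mid f(x)\le f(y)+\epsilon T_M(y,x)\ \text{for all }y\in D_x\}.$$ Then the problem of minimizing $f$ over $X$ is Tykhonov well-posed with respect to $M$ if and only if there exists $\bar x\in\bigcap_{\epsilon>0}\mathcal{G}(\epsilon)$ such that $f$ is bounded from below on $D_{\bar x}$ and $$\operatorname{diam}(\mathcal{G}'(\bar x,\epsilon))\to 0\quad\text{as }\epsilon\to 0,$$ where $$\mathcal{G}'(\bar x,\epsilon):=\{x\in D_{\bar x}\mid f(x)\le f(y)+\epsilon T_M(x,y)\ \text{for all }y\in D_{\bar x}\}.$$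
   Context: $\operatorname{cone}(M)=\{\lambda u\mid \lambda\ge 0,\ u\in M\}$ and $\operatorname{diam}(C)=\sup\{\|x-y\|\mid x,y\in C\}$. The minimal time function with respect to $M$ is $T_M(y,x):=\inf\{t\ge 0\mid x\in y+tM\}\in[0,\infty]$ for $y,x\in X$, with $\inf\emptyset=\infty$ (it is in general not symmetric; an inequality with right-hand side $\infty$ holds trivially). For $x\in X$, $D_x:=\{z\in X\mid T_M(z,x)<\infty\}$. A point $\bar x$ is a global minimum point of $f$ with respect to $M$ on $D_{\bar x}$ if $f(\bar x)\le f(x)$ for all $x\in D_{\bar x}$; it is the unique such point on $D_{\bar x}$ if moreover $f(\bar x)<f(x)$ for all $x\in D_{\bar x}\setminus\{\bar x\}$. The problem of minimizing $f$ over $X$ is Tykhonov well-posed with respect to $M$ if there exists $\bar x\in X$ such that (i) $\bar x$ is the unique global minimum point of $f$ with respect to $M$ on $D_{\bar x}$, and (ii) for every sequence $(x_k)\subset D_{\bar x}$ with $f(x_k)\to f(\bar x)$, one has $T_M(x_k,\bar x)\to 0$ as $k\to\infty$. *)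

theory Defs
  imports "HOL-Analysis.Analysis"
begin

definition lower_semicontinuous :: "('a::topological_space \<Rightarrow> real) \<Rightarrow> bool" where
  "lower_semicontinuous f \<longleftrightarrow> (\<forall>x. \<forall>a < f x. \<forall>\<^sub>F y in nhds x. a < f y)"

(* The library's real-valued diameter is unspecified on unbounded sets; this one is infinite there. *)
definition ediam :: "'a::real_normed_vector set \<Rightarrow> ennreal" where
  "ediam C = (SUP (x, y) \<in> C \<times> C. ennreal (norm (x - y)))"

(* Infimum taken in the extended reals, so that Inf {} = \<infinity>. *)
definition min_time :: "'a::real_normed_vector set \<Rightarrow> 'a \<Rightarrow> 'a \<Rightarrow> ereal" where
  "min_time M y x = Inf (ereal ` {t. 0 \<le> t \<and> x \<in> (\<lambda>u. y + t *\<^sub>R u) ` M})"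

definition min_time_dom :: "'a::real_normed_vector set \<Rightarrow> 'a \<Rightarrow> 'a set" where
  "min_time_dom M x = {z. min_time M z x < \<infinity>}"

definition global_min_point ::
    "'a::real_normed_vector set \<Rightarrow> ('a \<Rightarrow> real) \<Rightarrow> 'a \<Rightarrow> bool" where
  "global_min_point M f xb \<longleftrightarrow> (\<forall>x \<in> min_time_dom M xb. f xb \<le> f x)"

definition unique_global_min_point ::
    "'a::real_normed_vector set \<Rightarrow> ('a \<Rightarrow> real) \<Rightarrow> 'a \<Rightarrow> bool" where
  "unique_global_min_point M f xb \<longleftrightarrow>
     global_min_point M f xb \<and> (\<forall>x \<in> min_time_dom M xb - {xb}. f xb < f x)"

definition tykhonov_well_posed ::
    "'a::real_normed_vector set \<Rightarrow> ('a \<Rightarrow> real) \<Rightarrow> bool" where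
  "tykhonov_well_posed M f \<longleftrightarrow>
     (\<exists>xb. unique_global_min_point M f xb \<and>
        (\<forall>x :: nat \<Rightarrow> 'a. (\<forall>k. x k \<in> min_time_dom M xb) \<longrightarrow> (\<lambda>k. f (x k)) \<longlonglongrightarrow> f xb \<longrightarrow>
           (\<lambda>k. min_time M (x k) xb) \<longlonglongrightarrow> 0))"

definition approx_min_set ::
    "'a::real_normed_vector set \<Rightarrow> ('a \<Rightarrow> real) \<Rightarrow> real \<Rightarrow> 'a set" where
  "approx_min_set M f \<epsilon> =
     {x. \<forall>y \<in> min_time_dom M x. ereal (f x) \<le> ereal (f y) + ereal \<epsilon> * min_time M y x}"

(* Unlike in approx_min_set, the time here runs from x to y, so it may be infinite. *)
definition approx_min_set_at ::
    "'a::real_normed_vector set \<Rightarrow> ('a \<Rightarrow> real) \<Rightarrow> 'a \<Rightarrow> real \<Rightarrow> 'a set" where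
  "approx_min_set_at M f xb \<epsilon> =
     {x \<in> min_time_dom M xb. \<forall>y \<in> min_time_dom M xb.
        ereal (f x) \<le> ereal (f y) + ereal \<epsilon> * min_time M x y}"

end

theory Submission
  imports Defs
begin

text \<open>
  The bounds \<open>1 \<le> \<parallel>u\<parallel> \<le> B\<close> on \<open>M\<close> make the minimal time comparable with the norm,
  \<open>\<parallel>x - y\<parallel> / B \<le> T\<^sub>M(y,x) \<le> \<parallel>x - y\<parallel>\<close> whenever it is finite, and make \<open>cone(M)\<close> closed.
  If the problem is well-posed and points \<open>x\<^sub>k \<in> \<G>'(x\<^sub>*,\<epsilon>\<^sub>k)\<close> stay at distance \<open>\<delta>\<close> from the minimizer
  \<open>x\<^sub>*\<close>, then sliding them along the segment to \<open>x\<^sub>*\<close> until the distance is exactly \<open>\<delta>\<close>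
  yields, by convexity, a minimizing sequence not converging to \<open>x\<^sub>*\<close>.
  Conversely, Ekeland's principle places a point of \<open>\<G>'(x\<^sub>*,\<epsilon>)\<close> near every almost minimizer. As
  \<open>M\<close> need not be convex, \<open>T\<^sub>M\<close> may violate the triangle inequality, so the principle is applied
  to the norm with constant \<open>\<epsilon> / B\<close>.
\<close>

section \<open>Lower semicontinuity and Ekeland's principle\<close>

text \<open>A level strictly between \<open>c\<close> and \<open>f l\<close> would separate
  \<open>f (y n)\<close> from \<open>b n\<close> for large \<open>n\<close>. The bound varies with
  \<open>n\<close> because it will contain the distance to \<open>y n\<close>.\<close>

lemma lower_semicontinuous_seq_le:
  assumes f: "lower_semicontinuous f" and y: "y \<longlonglongrightarrow> l" and b: "b \<longlonglongrightarrow> c"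
    and le: "\<And>n. f (y n) \<le> b n"
  shows "f l \<le> c"
proof (rule ccontr)
  assume "\<not> f l \<le> c"
  then obtain a where a: "c < a" "a < f l"
    using dense[of c "f l"] by auto
  have "\<forall>\<^sub>F x in nhds l. a < f x"
    using f a(2) unfolding lower_semicontinuous_def by blast
  then have "\<forall>\<^sub>F n in sequentially. a < f (y n)"
    using y by (rule eventually_compose_filterlim)
  moreover have "\<forall>\<^sub>F n in sequentially. b n < a"
    using b a(1) by (rule order_tendstoD)
  ultimately have "\<forall>\<^sub>F n in sequentially. False"
    by eventually_elim (use le in \<open>meson le_less_trans less_asym less_le_trans\<close>)
  then show False by simp
qed

text \<open>On \<open>S\<close>, the relation \<open>y \<in> R x\<close> is a partial order. Nearly
  optimal descent makes the closed sets \<open>R (x n)\<close> shrink to a single point, which is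
  minimal for this order.\<close>

theorem ekeland_variational_principle:
  fixes S :: "'a::complete_space set" and f :: "'a \<Rightarrow> real"
  assumes S: "closed S" and f: "lower_semicontinuous f" and bdd: "bdd_below (f ` S)"
    and c: "0 < c" and x0: "x0 \<in> S"
  obtains z where "z \<in> S" "f z + c * dist x0 z \<le> f x0"
    "\<And>y. y \<in> S \<Longrightarrow> f z \<le> f y + c * dist z y"
proof -
  \<comment> \<open>\<open>R x\<close> collects the points whose decrease in \<open>f\<close> pays
    for the distance from \<open>x\<close> at rate \<open>c\<close>.\<close>
  define R where "R x = {y \<in> S. f y + c * dist x y \<le> f x}" for x
  have R_refl: "x \<in> R x" if "x \<in> S" for x
    using that by (simp add: R_def)
  have R_S: "R x \<subseteq> S" for x by (auto simp: R_def)
  have R_trans: "R y \<subseteq> R x" if "y \<in> R x" for x y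
  proof
    fix w assume w: "w \<in> R y"
    have "c * dist x w \<le> c * dist x y + c * dist y w"
      using c dist_triangle[of x w y] by (simp flip: distrib_left)
    then show "w \<in> R x" using w that by (auto simp: R_def)
  qed
  have closed_R: "closed (R x)" for x
    unfolding closed_sequential_limits
  proof (intro allI impI, elim conjE)
    fix y l assume y: "\<forall>n. y n \<in> R x" and l: "y \<longlonglongrightarrow> l"
    have "l \<in> S" using S y l R_S unfolding closed_sequential_limits by blast
    moreover have "f l \<le> f x - c * dist x l"
      by (rule lower_semicontinuous_seq_le[OF f l, of "\<lambda>n. f x - c * dist x (y n)"])
        (use y l in \<open>auto simp: R_def algebra_simps intro!: tendsto_intros\<close>)
    ultimately show "l \<in> R x" by (simp add: R_def)
  qed
  have ex: "\<exists>y. y \<in> S \<and> y \<in> R x \<and> (\<forall>w \<in> R x. f y \<le> f w + 1 / Suc n)" if "x \<in> S" for x n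
  proof -
    have b: "bdd_below (f ` R x)"
      using bdd by (rule bdd_below_mono) (use R_S in blast)
    have "f ` R x \<noteq> {}" using R_refl[OF that] by blast
    moreover have "Inf (f ` R x) < Inf (f ` R x) + 1 / Suc n" by simp
    ultimately obtain y where y: "y \<in> R x" "f y < Inf (f ` R x) + 1 / Suc n"
      using cInf_lessD[of "f ` R x"] by blast
    have "f y \<le> f w + 1 / Suc n" if "w \<in> R x" for w
      using y(2) cInf_lower[OF _ b, of "f w"] that by force
    then show ?thesis using y(1) R_S by blast
  qed
  \<comment> \<open>The clause on \<open>n = 0\<close> pins the start of the chain to
    \<open>x0\<close>.\<close>
  have "\<exists>x. \<forall>n. (x n \<in> S \<and> (n = 0 \<longrightarrow> x n = x0)) \<and>
      x (Suc n) \<in> R (x n) \<and> (\<forall>w \<in> R (x n). f (x (Suc n)) \<le> f w + 1 / Suc n)"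
    by (rule dependent_nat_choice) (use x0 ex in auto)
  then obtain x where xP: "\<And>n. x n \<in> S \<and> (n = 0 \<longrightarrow> x n = x0)"
    and step: "\<And>n. x (Suc n) \<in> R (x n) \<and> (\<forall>w \<in> R (x n). f (x (Suc n)) \<le> f w + 1 / Suc n)"
    by metis
  have x: "x 0 = x0" and xS: "x n \<in> S" for n using xP by auto
  have dec: "R (x n) \<subseteq> R (x m)" if "m \<le> n" for m n
    by (rule lift_Suc_antimono_le[of "\<lambda>n. R (x n)"]) (use R_trans step that in auto)
  \<comment> \<open>Since \<open>y\<close> also lies in \<open>R (x n)\<close>, moving from
    \<open>x (Suc n)\<close> to \<open>y\<close> lowers \<open>f\<close> by at most
    \<open>1 / Suc n\<close>, and this drop has to pay for the distance.\<close>
  have near: "dist (x (Suc n)) y \<le> 1 / Suc n / c" if "y \<in> R (x (Suc n))" for n y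
  proof -
    have "y \<in> R (x n)" using that R_trans step by blast
    then have "c * dist (x (Suc n)) y \<le> 1 / Suc n"
      using that step[of n] by (force simp: R_def)
    then show ?thesis using c by (simp add: pos_le_divide_eq mult_ac)
  qed
  have small: "\<exists>n. \<forall>u \<in> R (x n). \<forall>v \<in> R (x n). dist u v < e" if e: "0 < e" for e
  proof -
    have "0 < e * c / 2" using e c by simp
    from reals_Archimedean[OF this] obtain n where n: "inverse (Suc n) < e * c / 2" ..
    then have "1 / Suc n / c < e / 2"
      using c by (simp add: pos_divide_less_eq inverse_eq_divide mult_ac del: of_nat_Suc)
    then have "2 * (1 / Suc n / c) < e" by linarith
    then have "dist u v < e" if "u \<in> R (x (Suc n))" "v \<in> R (x (Suc n))" for u v
      using near[OF that(1)] near[OF that(2)] dist_triangle3[of u v "x (Suc n)"] by linarith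
    then show ?thesis by blast
  qed
  obtain z where z: "\<And>n. z \<in> R (x n)"
    using decreasing_closed_nest[of "\<lambda>n. R (x n)"] closed_R R_refl xS dec small by blast
  show ?thesis
  proof (rule that)
    show "z \<in> S" using z R_S by blast
    show "f z + c * dist x0 z \<le> f x0" using z[of 0] x by (simp add: R_def)
    fix y assume y: "y \<in> S"
    show "f z \<le> f y + c * dist z y"
    proof (rule ccontr)
      assume *: "\<not> f z \<le> f y + c * dist z y"
      \<comment> \<open>A violating \<open>y\<close> lies in \<open>R z\<close>, hence in every
        \<open>R (x n)\<close>, and so coincides with \<open>z\<close>.\<close>
      then have "y \<in> R z" using y by (simp add: R_def)
      then have "y \<in> R (x n)" for n using R_trans z by blast
      then have "dist z y < e" if "0 < e" for e using small[OF that] z by blast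
      then have "z = y" using zero_less_dist_iff by blast
      with * show False by simp
    qed
  qed
qed

section \<open>The minimal time function, its domain and the norm\<close>

lemma min_time_nonneg: "0 \<le> min_time M y x"
  unfolding min_time_def by (rule Inf_greatest) auto

text \<open>This turns finiteness of the time into membership in a cone, where scaling and
  closedness are available.\<close>

lemma min_time_dom_iff: "z \<in> min_time_dom M x \<longleftrightarrow> x - z \<in> cone hull M"
proof -
  have eq: "x = z + t *\<^sub>R u \<longleftrightarrow> x - z = t *\<^sub>R u" for t u
    by (simp add: algebra_simps)
  have "z \<in> min_time_dom M x \<longleftrightarrow> (\<exists>t. 0 \<le> t \<and> x \<in> (\<lambda>u. z + t *\<^sub>R u) ` M)"
    unfolding min_time_dom_def min_time_def mem_Collect_eq Inf_less_iff by auto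
  also have "\<dots> \<longleftrightarrow> x - z \<in> cone hull M"
    unfolding cone_hull_expl image_iff eq by blast
  finally show ?thesis .
qed

lemma self_in_min_time_dom:
  assumes "M \<noteq> {}" shows "x \<in> min_time_dom M x"
  using assms by (simp add: min_time_dom_iff cone_hull_contains_0)

text \<open>Every admissible \<open>t\<close> satisfies
  \<open>norm (x - y) = t * norm u \<le> t * B\<close>. Without an admissible \<open>t\<close> the
  time is infinite and the bound is trivial.\<close>

lemma norm_div_le_min_time:
  assumes B: "0 < B" "\<And>u. u \<in> M \<Longrightarrow> norm u \<le> B"
  shows "ereal (norm (x - y) / B) \<le> min_time M y x"
  unfolding min_time_def
proof (rule Inf_greatest, clarsimp simp: abs_of_nonneg)
  fix t :: real and u assume "0 \<le> t" "u \<in> M"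
  then have "t * norm u \<le> t * B" using B by (simp add: mult_left_mono)
  then show "t * norm u / B \<le> t" using B(1) \<open>0 \<le> t\<close> by (simp add: field_simps)
qed

text \<open>On the domain some \<open>t\<close> is admissible, and
  \<open>t \<le> t * norm u = norm (x - y)\<close>. Off the domain the time is infinite.\<close>

lemma min_time_le_norm:
  assumes M: "\<forall>u \<in> M. 1 \<le> norm u" and y: "y \<in> min_time_dom M x"
  shows "min_time M y x \<le> ereal (norm (x - y))"
proof -
  obtain t u where t: "0 \<le> t" "u \<in> M" "x - y = t *\<^sub>R u"
    using y unfolding min_time_dom_iff cone_hull_expl by blast
  have "min_time M y x \<le> ereal t"
    unfolding min_time_def
    by (rule Inf_lower) (use t in \<open>auto simp: algebra_simps intro!: imageI image_eqI[of _ _ u]\<close>)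
  also have "t \<le> t * norm u" using t M mult_left_mono[of 1 "norm u" t] by auto
  then have "ereal t \<le> ereal (norm (x - y))" using t by simp
  finally show ?thesis .
qed

text \<open>Write the sequence as \<open>t n *\<^sub>R u n\<close>. The lower norm bound on
  \<open>M\<close> keeps the scalars bounded, so a subsequence converges to some \<open>s\<close>;
  the upper bound forces \<open>0 < s\<close> unless the limit is 0. Dividing by the scalars then
  makes the \<open>u n\<close> converge inside \<open>M\<close>.\<close>

lemma closed_cone_hull_of_bounded_away:
  fixes M :: "'a::real_normed_vector set"
  assumes "M \<noteq> {}" and cl: "closed M" and bdd: "bounded M" and M: "\<forall>u \<in> M. 1 \<le> norm u"
  shows "closed (cone hull M)"
  unfolding closed_sequential_limits
proof (intro allI impI, elim conjE)
  fix w l assume w: "\<forall>n. w n \<in> cone hull M" and l: "w \<longlonglongrightarrow> l"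
  show "l \<in> cone hull M"
  proof (cases "l = 0")
    case True
    then show ?thesis using assms(1) by (simp add: cone_hull_contains_0)
  next
    case False
    obtain B where B: "0 < B" "\<And>u. u \<in> M \<Longrightarrow> norm u \<le> B"
      using bdd bounded_pos by blast
    have "\<forall>n. \<exists>t u. 0 \<le> t \<and> u \<in> M \<and> w n = t *\<^sub>R u"
      using w unfolding cone_hull_expl by blast
    then obtain t u where tu: "\<And>n. 0 \<le> t n" "\<And>n. u n \<in> M" "\<And>n. w n = t n *\<^sub>R u n"
      by metis
    have norm_w: "norm (w n) = t n * norm (u n)" for n using tu by simp
    have tw: "t n \<le> norm (w n)" for n
      using mult_left_mono[of 1 "norm (u n)" "t n"] tu M norm_w by auto
    have wt: "norm (w n) \<le> t n * B" for n
      unfolding norm_w using tu B by (simp add: mult_left_mono)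
    have "bounded (range w)" using l convergent_imp_bounded by blast
    then obtain C where C: "\<And>n. norm (w n) \<le> C" unfolding bounded_iff by auto
    have "\<forall>n. t n \<in> {0..C}" using tu tw C order_trans by fastforce
    then obtain s r where s: "strict_mono r" "(t \<circ> r) \<longlonglongrightarrow> s"
      using compact_Icc[of 0 C] unfolding compact_def by metis
    have wr: "(w \<circ> r) \<longlonglongrightarrow> l" using LIMSEQ_subseq_LIMSEQ[OF l s(1)] .
    have "norm l \<le> s * B"
      by (rule LIMSEQ_le[OF tendsto_norm[OF wr] tendsto_mult_right[OF s(2)]])
        (use wt in auto)
    then have "0 < s" using False B(1)
      by (smt (verit) mult_nonpos_nonneg zero_less_norm_iff)
    then have "(\<lambda>n. inverse ((t \<circ> r) n) *\<^sub>R (w \<circ> r) n) \<longlonglongrightarrow> inverse s *\<^sub>R l"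
      by (intro tendsto_intros s wr) auto
    \<comment> \<open>This holds only eventually, as finitely many of the scalars may
      vanish.\<close>
    moreover have "\<forall>\<^sub>F n in sequentially. inverse ((t \<circ> r) n) *\<^sub>R (w \<circ> r) n = u (r n)"
      using order_tendstoD(1)[OF s(2) \<open>0 < s\<close>] by eventually_elim (simp add: tu)
    ultimately have ur: "(\<lambda>n. u (r n)) \<longlonglongrightarrow> inverse s *\<^sub>R l"
      by (rule Lim_transform_eventually)
    have "inverse s *\<^sub>R l \<in> M"
      by (rule closed_sequentially[OF cl _ ur]) (rule tu(2))
    then have "s *\<^sub>R inverse s *\<^sub>R l \<in> cone hull M"
      unfolding cone_hull_expl using \<open>0 < s\<close> less_imp_le by blast
    then show ?thesis using \<open>0 < s\<close> by simp
  qed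
qed

lemma closed_min_time_dom:
  fixes M :: "'a::real_normed_vector set"
  assumes "closed (cone hull M)"
  shows "closed (min_time_dom M x)"
proof -
  have "min_time_dom M x = (\<lambda>z. x - z) -` (cone hull M)"
    by (auto simp: min_time_dom_iff)
  then show ?thesis
    using assms by (auto intro!: continuous_closed_vimage continuous_intros)
qed

section \<open>Diameter estimates\<close>

lemma ediam_le:
  assumes "\<And>x. x \<in> C \<Longrightarrow> norm (x - a) \<le> d"
  shows "ediam C \<le> ennreal (2 * d)"
  unfolding ediam_def
proof (rule SUP_least, clarsimp)
  fix x y assume "x \<in> C" "y \<in> C"
  then have "norm (x - a) + norm (y - a) \<le> 2 * d" using assms[of x] assms[of y] by simp
  moreover have "norm (x - y) \<le> norm (x - a) + norm (y - a)"
    using norm_triangle_ineq4[of "x - a" "y - a"] by simp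
  ultimately show "ennreal (norm (x - y)) \<le> ennreal (2 * d)"
    by (intro ennreal_leI) linarith
qed

lemma norm_diff_le_ediam:
  assumes "x \<in> C" "y \<in> C"
  shows "ennreal (norm (x - y)) \<le> ediam C"
  unfolding ediam_def using assms by (intro SUP_upper2[of "(x, y)"]) auto

section \<open>Global minimum points and approximate minimizers\<close>

text \<open>The penalty is nonnegative and, the time being finite on the domain, tends to 0 with
  \<open>\<epsilon>\<close>.\<close>

lemma global_min_point_iff_in_all_approx_min_sets:
  "global_min_point M f xb \<longleftrightarrow> xb \<in> (\<Inter>\<epsilon> \<in> {0<..}. approx_min_set M f \<epsilon>)"
proof
  assume min: "global_min_point M f xb"
  have "ereal (f xb) \<le> ereal (f y) + ereal \<epsilon> * min_time M y xb"
    if "0 < \<epsilon>" "y \<in> min_time_dom M xb" for \<epsilon> y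
  proof -
    have "ereal (f xb) \<le> ereal (f y) + 0"
      using min that unfolding global_min_point_def by simp
    also have "\<dots> \<le> ereal (f y) + ereal \<epsilon> * min_time M y xb"
      using that min_time_nonneg by (intro add_left_mono) (simp add: ereal_zero_le_0_iff)
    finally show ?thesis .
  qed
  then show "xb \<in> (\<Inter>\<epsilon> \<in> {0<..}. approx_min_set M f \<epsilon>)"
    by (auto simp: approx_min_set_def)
next
  assume xb: "xb \<in> (\<Inter>\<epsilon> \<in> {0<..}. approx_min_set M f \<epsilon>)"
  show "global_min_point M f xb"
    unfolding global_min_point_def
  proof
    fix y assume y: "y \<in> min_time_dom M xb"
    then obtain t where t: "min_time M y xb = ereal t" "0 \<le> t"
      using min_time_nonneg[of M y xb] unfolding min_time_dom_def
      by (cases "min_time M y xb") auto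
    have le: "f xb \<le> f y + \<epsilon> * t" if "0 < \<epsilon>" for \<epsilon>
      using xb that y t by (force simp: approx_min_set_def)
    show "f xb \<le> f y"
    proof (rule field_le_epsilon)
      fix e :: real assume e: "0 < e"
      \<comment> \<open>The denominator \<open>t + 1\<close> also covers
        \<open>t = 0\<close>.\<close>
      have "e / (t + 1) * t \<le> e" using e t(2) by (simp add: field_simps)
      then show "f xb \<le> f y + e" using le[of "e / (t + 1)"] e t(2) by simp
    qed
  qed
qed

text \<open>The penalty is nonnegative. This serves both \<open>xb\<close> itself and a hypothetical
  second minimizer.\<close>

lemma global_minimizer_in_approx_min_set_at:
  assumes "x \<in> min_time_dom M xb" "\<And>y. y \<in> min_time_dom M xb \<Longrightarrow> f x \<le> f y" "0 < \<epsilon>"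
  shows "x \<in> approx_min_set_at M f xb \<epsilon>"
proof -
  have "ereal (f x) \<le> ereal (f y) + ereal \<epsilon> * min_time M x y" if "y \<in> min_time_dom M xb" for y
  proof -
    have "ereal (f x) \<le> ereal (f y) + 0" using assms that by simp
    also have "\<dots> \<le> ereal (f y) + ereal \<epsilon> * min_time M x y"
      using assms(3) min_time_nonneg by (intro add_left_mono) (simp add: ereal_zero_le_0_iff)
    finally show ?thesis .
  qed
  then show ?thesis using assms(1) by (simp add: approx_min_set_at_def)
qed

section \<open>Well-posedness makes the diameters vanish\<close>

text \<open>The approximate minimizers are confined to small balls about \<open>xb\<close>. Sliding
  to a fixed distance \<open>d\<close> keeps the excess \<open>e * d\<close> small even for points
  that run off to infinity.\<close>

lemma ediam_approx_min_set_at_tendsto_0: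
  fixes M :: "'a::real_normed_vector set" and f :: "'a \<Rightarrow> real"
  assumes ne: "M \<noteq> {}" and bdd: "bounded M" and M: "\<forall>u \<in> M. 1 \<le> norm u"
    and f: "convex_on UNIV f"
    and tyk: "\<And>x :: nat \<Rightarrow> 'a. (\<And>k. x k \<in> min_time_dom M xb) \<Longrightarrow>
      (\<lambda>k. f (x k)) \<longlonglongrightarrow> f xb \<Longrightarrow> (\<lambda>k. min_time M (x k) xb) \<longlonglongrightarrow> 0"
    and min: "global_min_point M f xb"
  shows "((\<lambda>\<epsilon>. ediam (approx_min_set_at M f xb \<epsilon>)) \<longlongrightarrow> 0) (at_right 0)"
proof -
  obtain B where B: "0 < B" "\<And>u. u \<in> M \<Longrightarrow> norm u \<le> B"
    using bdd bounded_pos by blast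
  have slide: "\<exists>z \<in> min_time_dom M xb. norm (xb - z) = d \<and> f z \<le> f xb + e * d"
    if x: "x \<in> approx_min_set_at M f xb e" and d: "0 < d" "d \<le> norm (x - xb)" and e: "0 < e"
    for x d e
  proof -
    \<comment> \<open>The fraction \<open>l\<close> of the segment puts \<open>z\<close> at distance
      exactly \<open>d\<close> from \<open>xb\<close>.\<close>
    define l where "l = d / norm (x - xb)"
    define z where "z = (1 - l) *\<^sub>R xb + l *\<^sub>R x"
    have "0 < norm (x - xb)" using d by linarith
    then have l: "0 < l" "l \<le> 1" "l * norm (x - xb) = d"
      using d by (auto simp: l_def divide_le_eq_1)
    have xD: "x \<in> min_time_dom M xb" using x by (simp add: approx_min_set_at_def)
    have xz: "xb - z = l *\<^sub>R (xb - x)" by (simp add: z_def algebra_simps)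
    have "xb - z \<in> cone hull M"
      unfolding xz using xD l cone_cone_hull[of M] by (auto simp: min_time_dom_iff cone_def)
    then have zD: "z \<in> min_time_dom M xb" by (simp add: min_time_dom_iff)
    \<comment> \<open>Membership is tested at \<open>xb\<close>, to which the time from
      \<open>x\<close> is finite.\<close>
    have "ereal (f x) \<le> ereal (f xb) + ereal e * min_time M x xb"
      using x self_in_min_time_dom[OF ne] by (auto simp: approx_min_set_at_def)
    also have "\<dots> \<le> ereal (f xb) + ereal e * ereal (norm (xb - x))"
      using min_time_le_norm[OF M xD] e by (intro add_left_mono ereal_mult_left_mono) auto
    finally have fx: "f x \<le> f xb + e * norm (x - xb)" by (simp add: norm_minus_commute)
    have "f z \<le> (1 - l) * f xb + l * f x"
      unfolding z_def using convex_onD[OF f, of l xb x] l by simp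
    also have "\<dots> \<le> (1 - l) * f xb + l * (f xb + e * norm (x - xb))"
      using fx l by (intro add_left_mono mult_left_mono) auto
    also have "\<dots> = f xb + e * (l * norm (x - xb))" by (simp add: algebra_simps)
    finally have "f z \<le> f xb + e * d" using l(3) by simp
    moreover have "norm (xb - z) = d" using l by (simp add: xz norm_minus_commute)
    ultimately show ?thesis using zD by blast
  qed
  have near: "\<exists>e0 > 0. \<forall>e. 0 < e \<and> e < e0 \<longrightarrow>
      (\<forall>x \<in> approx_min_set_at M f xb e. norm (x - xb) \<le> d)" if d: "0 < d" for d
  proof (rule ccontr)
    assume neg: "\<not> ?thesis"
    \<comment> \<open>A failure gives, for each \<open>k\<close>, a parameter below
      \<open>inverse (Suc k)\<close> and a point farther than \<open>d\<close> from
      \<open>xb\<close>, which can be slid.\<close>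
    have "\<exists>z \<in> min_time_dom M xb. norm (xb - z) = d \<and> f z \<le> f xb + inverse (Suc k) * d" for k
    proof -
      obtain e x where e: "0 < e" "e < inverse (Suc k)"
        and x: "x \<in> approx_min_set_at M f xb e" "d < norm (x - xb)"
        using neg by (metis inverse_positive_iff_positive not_le of_nat_0_less_iff zero_less_Suc)
      have "e * d \<le> inverse (Suc k) * d" using e d by (intro mult_right_mono) auto
      then show ?thesis using slide[OF x(1) d _ e(1)] x(2) by force
    qed
    then obtain z where z: "\<And>k. z k \<in> min_time_dom M xb" "\<And>k. norm (xb - z k) = d"
      "\<And>k. f (z k) \<le> f xb + inverse (Suc k) * d" by metis
    have "(\<lambda>k. f xb + inverse (real (Suc k)) * d) \<longlonglongrightarrow> f xb + 0 * d"
      by (intro tendsto_intros LIMSEQ_inverse_real_of_nat)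
    then have lim: "(\<lambda>k. f xb + inverse (real (Suc k)) * d) \<longlonglongrightarrow> f xb" by simp
    have "f xb \<le> f (z k)" for k using z(1) min by (simp add: global_min_point_def)
    then have "(\<lambda>k. f (z k)) \<longlonglongrightarrow> f xb"
      using z(3) by (intro tendsto_sandwich[OF _ _ tendsto_const lim] always_eventually) blast+
    then have "(\<lambda>k. min_time M (z k) xb) \<longlonglongrightarrow> 0" using tyk z(1) by blast
    \<comment> \<open>Each \<open>z k\<close> is at distance \<open>d\<close>, so its time to
      \<open>xb\<close> is at least \<open>d / B\<close>.\<close>
    then have "ereal (d / B) \<le> 0"
      by (rule LIMSEQ_le_const) (use norm_div_le_min_time[OF B] z(2) in metis)
    then show False using d B(1) by (simp add: divide_le_0_iff)
  qed
  show ?thesis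
  proof (rule order_tendstoI)
    fix a :: ennreal assume "0 < a"
    then obtain b where b: "0 < b" "b < a" using dense by blast
    define d where "d = enn2real b / 2"
    \<comment> \<open>Finiteness of \<open>b\<close> matters: \<open>enn2real\<close> sends
      \<open>top\<close> to 0.\<close>
    have "b < top" using b(2) by (rule less_le_trans) simp
    then have d: "0 < d" "ennreal (2 * d) = b"
      using b(1) by (auto simp: d_def enn2real_positive_iff)
    obtain e0 where e0: "0 < e0" "\<And>e x. 0 < e \<Longrightarrow> e < e0 \<Longrightarrow>
        x \<in> approx_min_set_at M f xb e \<Longrightarrow> norm (x - xb) \<le> d"
      using near[OF d(1)] by blast
    have "ediam (approx_min_set_at M f xb e) < a" if "0 < e" "e < e0" for e
      using ediam_le[of "approx_min_set_at M f xb e" xb d] e0(2)[OF that] d(2) b(2) by force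
    then show "\<forall>\<^sub>F e in at_right 0. ediam (approx_min_set_at M f xb e) < a"
      unfolding eventually_at_right_field using e0(1) by blast
  qed simp
qed

section \<open>Vanishing diameters give well-posedness\<close>

text \<open>Ekeland's principle started at \<open>x k\<close> yields \<open>z\<close> within
  \<open>d / 2\<close> of \<open>x k\<close>. Both \<open>z\<close> and \<open>xb\<close> lie in one
  approximate set of diameter below \<open>d / 2\<close>.\<close>

lemma minimizing_sequence_tendsto:
  fixes M :: "'a::banach set" and f :: "'a \<Rightarrow> real"
  assumes ne: "M \<noteq> {}" and cl: "closed M" and bdd: "bounded M" and M: "\<forall>u \<in> M. 1 \<le> norm u"
    and f: "lower_semicontinuous f" and min: "global_min_point M f xb"
    and diam: "((\<lambda>\<epsilon>. ediam (approx_min_set_at M f xb \<epsilon>)) \<longlongrightarrow> 0) (at_right 0)"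
    and x: "\<And>k :: nat. x k \<in> min_time_dom M xb" and fx: "(\<lambda>k. f (x k)) \<longlonglongrightarrow> f xb"
  shows "x \<longlonglongrightarrow> xb"
proof (rule metric_LIMSEQ_I)
  fix d :: real assume d: "0 < d"
  obtain B where B: "0 < B" "\<And>u. u \<in> M \<Longrightarrow> norm u \<le> B"
    using bdd bounded_pos by blast
  let ?D = "min_time_dom M xb"
  have xbD: "xb \<in> ?D" using self_in_min_time_dom[OF ne] .
  have "\<forall>\<^sub>F e in at_right 0. ediam (approx_min_set_at M f xb e) < ennreal (d / 2)"
    using order_tendstoD(2)[OF diam] d by simp
  then have "\<forall>\<^sub>F e in at_right 0. 0 < e \<and> ediam (approx_min_set_at M f xb e) < ennreal (d / 2)"
    using eventually_at_right_less[of 0] by eventually_elim auto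
  then obtain e where e: "0 < e" "ediam (approx_min_set_at M f xb e) < ennreal (d / 2)"
    using eventually_happens'[OF trivial_limit_at_right_real] by blast
  \<comment> \<open>With this constant the penalty \<open>c * dist z y\<close> is at most
    \<open>e * min_time M z y\<close>.\<close>
  define c where "c = e / B"
  have c: "0 < c" using e B(1) by (simp add: c_def)
  have "\<forall>\<^sub>F k in sequentially. f (x k) < f xb + c * (d / 2)"
    by (rule order_tendstoD(2)[OF fx]) (use c d in simp)
  then obtain N where N: "\<And>k. N \<le> k \<Longrightarrow> f (x k) < f xb + c * (d / 2)"
    unfolding eventually_sequentially by blast
  have "dist (x k) xb < d" if "N \<le> k" for k
  proof -
    have bb: "bdd_below (f ` ?D)"
      using min unfolding global_min_point_def by (auto intro: bdd_belowI)
    obtain z where z: "z \<in> ?D" "f z + c * dist (x k) z \<le> f (x k)"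
      "\<And>y. y \<in> ?D \<Longrightarrow> f z \<le> f y + c * dist z y"
      by (rule ekeland_variational_principle[OF
            closed_min_time_dom[OF closed_cone_hull_of_bounded_away[OF ne cl bdd M]] f bb c x[of k]])
        blast
    have "ereal (f z) \<le> ereal (f y) + ereal e * min_time M z y" if "y \<in> ?D" for y
    proof -
      have "ereal (f z) \<le> ereal (f y) + ereal e * ereal (norm (y - z) / B)"
        using z(3)[OF that] by (simp add: c_def dist_norm norm_minus_commute)
      also have "\<dots> \<le> ereal (f y) + ereal e * min_time M z y"
        using norm_div_le_min_time[OF B] e by (intro add_left_mono ereal_mult_left_mono) auto
      finally show ?thesis .
    qed
    then have "z \<in> approx_min_set_at M f xb e" using z(1) by (simp add: approx_min_set_at_def)
    moreover have "xb \<in> approx_min_set_at M f xb e"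
      by (rule global_minimizer_in_approx_min_set_at[OF xbD _ e(1)])
        (use min in \<open>auto simp: global_min_point_def\<close>)
    ultimately have "ennreal (norm (z - xb)) < ennreal (d / 2)"
      using norm_diff_le_ediam e(2) le_less_trans by blast
    then have zx: "dist z xb < d / 2" by (simp add: dist_norm ennreal_less_iff)
    have "f xb \<le> f z" using min z(1) by (simp add: global_min_point_def)
    \<comment> \<open>As \<open>f z\<close> cannot drop below \<open>f xb\<close>, the descent from
      \<open>x k\<close> to \<open>z\<close> is less than \<open>c * (d / 2)\<close>.\<close>
    then have "c * dist (x k) z < c * (d / 2)" using z(2) N[OF \<open>N \<le> k\<close>] by linarith
    then have "dist (x k) z < d / 2" using c by simp
    then show ?thesis using zx dist_triangle[of "x k" xb z] by linarith
  qed
  then show "\<exists>N. \<forall>k\<ge>N. dist (x k) xb < d" by blast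
qed

text \<open>A second minimizer would share every approximate set with \<open>xb\<close>, so its
  distance to \<open>xb\<close> would bound all the diameters from below.\<close>

lemma unique_global_min_point_if_ediam_tendsto_0:
  assumes ne: "M \<noteq> {}" and min: "global_min_point M f xb"
    and diam: "((\<lambda>\<epsilon>. ediam (approx_min_set_at M f xb \<epsilon>)) \<longlongrightarrow> 0) (at_right 0)"
  shows "unique_global_min_point M f xb"
  unfolding unique_global_min_point_def
proof (intro conjI min ballI)
  fix x assume x: "x \<in> min_time_dom M xb - {xb}"
  show "f xb < f x"
  proof (rule ccontr)
    assume neg: "\<not> f xb < f x"
    have le: "ennreal (norm (x - xb)) \<le> ediam (approx_min_set_at M f xb e)" if "0 < e" for e
    proof (intro norm_diff_le_ediam global_minimizer_in_approx_min_set_at that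
        self_in_min_time_dom ne)
      show "x \<in> min_time_dom M xb" using x by simp
    next
      fix y assume "y \<in> min_time_dom M xb"
      then show "f xb \<le> f y" using min by (simp add: global_min_point_def)
      then show "f x \<le> f y" using neg by simp
    qed
    have "\<forall>\<^sub>F e in at_right 0. ennreal (norm (x - xb)) \<le> ediam (approx_min_set_at M f xb e)"
      using eventually_at_right_less[of 0] by eventually_elim (rule le)
    then have "ennreal (norm (x - xb)) \<le> 0"
      using tendsto_lowerbound[OF diam] by simp
    then show False using x by simp
  qed
qed

section \<open>The equivalence\<close>

text \<open>Both directions keep the same point \<open>xb\<close>: lying in every
  \<open>approx_min_set M f \<epsilon>\<close> amounts to being a global minimum point on its own
  domain.\<close>

theorem theorem4p4:
  fixes M :: "'a::banach set" and f :: "'a \<Rightarrow> real"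
  assumes "M \<noteq> {}" and "closed M" and "bounded M"
    and "\<forall>u \<in> M. 1 \<le> norm u"
    and "convex (cone hull M)"
    and "lower_semicontinuous f" and "convex_on UNIV f"
  shows "tykhonov_well_posed M f \<longleftrightarrow>
    (\<exists>xb \<in> (\<Inter>\<epsilon> \<in> {0<..}. approx_min_set M f \<epsilon>).
       bdd_below (f ` min_time_dom M xb) \<and>
       ((\<lambda>\<epsilon>. ediam (approx_min_set_at M f xb \<epsilon>)) \<longlongrightarrow> 0) (at_right 0))"
proof
  assume "tykhonov_well_posed M f"
  then obtain xb where min: "global_min_point M f xb"
    and tyk: "\<And>x :: nat \<Rightarrow> 'a. (\<And>k. x k \<in> min_time_dom M xb) \<Longrightarrow>
      (\<lambda>k. f (x k)) \<longlonglongrightarrow> f xb \<Longrightarrow> (\<lambda>k. min_time M (x k) xb) \<longlonglongrightarrow> 0"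
    unfolding tykhonov_well_posed_def unique_global_min_point_def by blast
  have "bdd_below (f ` min_time_dom M xb)"
    using min unfolding global_min_point_def by (auto intro: bdd_belowI)
  then show "\<exists>xb \<in> (\<Inter>\<epsilon> \<in> {0<..}. approx_min_set M f \<epsilon>).
       bdd_below (f ` min_time_dom M xb) \<and>
       ((\<lambda>\<epsilon>. ediam (approx_min_set_at M f xb \<epsilon>)) \<longlongrightarrow> 0) (at_right 0)"
    by (intro bexI[of _ xb] conjI ediam_approx_min_set_at_tendsto_0[OF assms(1,3,4,7) tyk min])
      (use min in \<open>simp_all only: global_min_point_iff_in_all_approx_min_sets\<close>)
next
  assume "\<exists>xb \<in> (\<Inter>\<epsilon> \<in> {0<..}. approx_min_set M f \<epsilon>).
       bdd_below (f ` min_time_dom M xb) \<and>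
       ((\<lambda>\<epsilon>. ediam (approx_min_set_at M f xb \<epsilon>)) \<longlongrightarrow> 0) (at_right 0)"
  then obtain xb where min: "global_min_point M f xb"
    and diam: "((\<lambda>\<epsilon>. ediam (approx_min_set_at M f xb \<epsilon>)) \<longlongrightarrow> 0) (at_right 0)"
    using global_min_point_iff_in_all_approx_min_sets by blast
  have "(\<lambda>k. min_time M (x k) xb) \<longlonglongrightarrow> 0"
    if x: "\<And>k. x k \<in> min_time_dom M xb" and fx: "(\<lambda>k. f (x k)) \<longlonglongrightarrow> f xb"
    for x :: "nat \<Rightarrow> 'a"
  proof -
    have "x \<longlonglongrightarrow> xb"
      by (rule minimizing_sequence_tendsto[OF assms(1-4,6) min diam x fx])
    then have "(\<lambda>k. norm (xb - x k)) \<longlonglongrightarrow> norm (xb - xb)" by (intro tendsto_intros)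
    then have "(\<lambda>k. ereal (norm (xb - x k))) \<longlonglongrightarrow> 0"
      by (simp add: zero_ereal_def)
    \<comment> \<open>The time from \<open>x k\<close> to \<open>xb\<close> is squeezed between 0
      and the norm, since \<open>x k\<close> lies in the domain.\<close>
    then show ?thesis
      by (rule tendsto_sandwich[OF _ _ tendsto_const, rotated 2])
        (simp_all add: min_time_nonneg min_time_le_norm[OF assms(4) x])
  qed
  then show "tykhonov_well_posed M f"
    unfolding tykhonov_well_posed_def
    by (intro exI[of _ xb] conjI allI impI
        unique_global_min_point_if_ediam_tendsto_0[OF assms(1) min diam]) simp
qed

end
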